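(* Let $A$ be a Minkowski Dedekind domain and $n$ a positive integer. For an ideal $I$ of $A$ the following are equivalent: (1) $I$ is $n$-congruing; (2) for every maximal ideal $\mathfrak p$ of $A$, the ideal $\hat I_{\mathfrak p}=I\hat A_{\mathfrak p}$ of $\hat A_{\mathfrak p}$ is $n$-congruing; (3) $\ker pr_n\subseteq I$. Consequently $\ker pr_n$ is the unique minimal $n$-congruing ideal of $A$.
   Context: An ideal $I$ of a commutative ring $A$ is $n$-congruing if for every $a\in A$ there is $N\in\mathbb{N}$ with $a^N(a^n-1)\in I$. A Dedekind domain $A$ is Minkowski if all residue fields $A/\mathfrak p$ are finite and for each $N$ only finitely many maximal ideals $\mathfrak p$ have $\#(A/\mathfrak p)<N$. For a maximal ideal $\mathfrak p$, $H^{\mathfrak p}_n$ is the ideal of the completion $\hat A_{\mathfrak p}$ generated by all $x^n-1$ with $x\in\hat A_{\mathfrak p}^\times$, and $pr_n:A\to\prod_{\mathfrak p}\hat A_{\mathfrak p}/H^{\mathfrak p}_n$ (product over all maximal ideals) is the ring homomorphism whose $\mathfrak p$-component is completion followed by reduction modulo $H^{\mathfrak p}_n$. *)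

theory Defs
  imports "HOL-Algebra.Algebra"
begin

text \<open>Integrally closed: every element a/b (b nonzero) of the fraction field that is a root
  of a monic polynomial with coefficients in R already lies in R.  Written out without the
  fraction field: clearing denominators, a^m + sum_{i<m} c_i a^i b^(m-i) = 0 implies b divides a.\<close>
definition integrally_closed :: "('a, 'b) ring_scheme \<Rightarrow> bool" where
  "integrally_closed R \<longleftrightarrow>
     (\<forall>a\<in>carrier R. \<forall>b\<in>carrier R. b \<noteq> \<zero>\<^bsub>R\<^esub> \<longrightarrow>
        (\<exists>m::nat. m > 0 \<and> (\<exists>c \<in> {..<m} \<rightarrow> carrier R.
            a [^]\<^bsub>R\<^esub> m \<oplus>\<^bsub>R\<^esub>
              (\<Oplus>\<^bsub>R\<^esub>i\<in>{..<m}. c i \<otimes>\<^bsub>R\<^esub> a [^]\<^bsub>R\<^esub> i \<otimes>\<^bsub>R\<^esub> b [^]\<^bsub>R\<^esub> (m - i))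
            = \<zero>\<^bsub>R\<^esub>))
        \<longrightarrow> (\<exists>d\<in>carrier R. a = b \<otimes>\<^bsub>R\<^esub> d))"

definition dedekind_domain :: "('a, 'b) ring_scheme \<Rightarrow> bool" where
  "dedekind_domain R \<longleftrightarrow> noetherian_domain R \<and> integrally_closed R \<and>
     (\<forall>P. primeideal P R \<and> P \<noteq> {\<zero>\<^bsub>R\<^esub>} \<longrightarrow> maximalideal P R)"

definition minkowski :: "('a, 'b) ring_scheme \<Rightarrow> bool" where
  "minkowski R \<longleftrightarrow> dedekind_domain R \<and>
     (\<forall>P. maximalideal P R \<longrightarrow> finite (carrier (R Quot P))) \<and>
     (\<forall>N::nat. finite {P. maximalideal P R \<and> card (carrier (R Quot P)) < N})"

definition n_congruing :: "('a, 'b) ring_scheme \<Rightarrow> nat \<Rightarrow> 'a set \<Rightarrow> bool" where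
  "n_congruing R n I \<longleftrightarrow> ideal I R \<and>
     (\<forall>a\<in>carrier R. \<exists>N::nat. a [^]\<^bsub>R\<^esub> N \<otimes>\<^bsub>R\<^esub> (a [^]\<^bsub>R\<^esub> n \<ominus>\<^bsub>R\<^esub> \<one>\<^bsub>R\<^esub>) \<in> I)"

definition ideal_pow :: "('a, 'b) ring_scheme \<Rightarrow> 'a set \<Rightarrow> nat \<Rightarrow> 'a set" where
  "ideal_pow R P k = ((\<lambda>J. P \<cdot>\<^bsub>R\<^esub> J) ^^ k) (carrier R)"

text \<open>Elements of the completion are compatible families (x_k)_k with x_k in R/P^k;
  operations are componentwise in the quotient rings R/P^k.\<close>
definition completion :: "('a, 'b) ring_scheme \<Rightarrow> 'a set \<Rightarrow> (nat \<Rightarrow> 'a set) ring" where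
  "completion R P =
     \<lparr> partial_object.carrier = {x. (\<forall>k. x k \<in> carrier (R Quot ideal_pow R P k)) \<and> (\<forall>k. x (Suc k) \<subseteq> x k)},
       monoid.mult = (\<lambda>x y k. x k \<otimes>\<^bsub>R Quot ideal_pow R P k\<^esub> y k),
       monoid.one = (\<lambda>k. \<one>\<^bsub>R Quot ideal_pow R P k\<^esub>),
       ring.zero = (\<lambda>k. \<zero>\<^bsub>R Quot ideal_pow R P k\<^esub>),
       ring.add = (\<lambda>x y k. x k \<oplus>\<^bsub>R Quot ideal_pow R P k\<^esub> y k) \<rparr>"

definition compl_map :: "('a, 'b) ring_scheme \<Rightarrow> 'a set \<Rightarrow> 'a \<Rightarrow> (nat \<Rightarrow> 'a set)" where
  "compl_map R P a = (\<lambda>k. ideal_pow R P k +>\<^bsub>R\<^esub> a)"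

definition compl_ideal :: "('a, 'b) ring_scheme \<Rightarrow> 'a set \<Rightarrow> 'a set \<Rightarrow> (nat \<Rightarrow> 'a set) set" where
  "compl_ideal R P I = Idl\<^bsub>completion R P\<^esub> (compl_map R P ` I)"

definition H_ideal :: "('a, 'b) ring_scheme \<Rightarrow> nat \<Rightarrow> 'a set \<Rightarrow> (nat \<Rightarrow> 'a set) set" where
  "H_ideal R n P = Idl\<^bsub>completion R P\<^esub>
     {x [^]\<^bsub>completion R P\<^esub> n \<ominus>\<^bsub>completion R P\<^esub> \<one>\<^bsub>completion R P\<^esub> | x.
        x \<in> Units (completion R P)}"

definition pr_comp :: "('a, 'b) ring_scheme \<Rightarrow> nat \<Rightarrow> 'a set \<Rightarrow> 'a \<Rightarrow> (nat \<Rightarrow> 'a set) set" where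
  "pr_comp R n P a = H_ideal R n P +>\<^bsub>completion R P\<^esub> compl_map R P a"

text \<open>Kernel of pr_n : A \<rightarrow> prod_P \<hat>A_P / H^P_n (product over all maximal ideals P):
  the elements whose every component is zero.\<close>
definition ker_pr :: "('a, 'b) ring_scheme \<Rightarrow> nat \<Rightarrow> 'a set" where
  "ker_pr R n = {a \<in> carrier R. \<forall>P. maximalideal P R \<longrightarrow>
      pr_comp R n P a = \<zero>\<^bsub>completion R P Quot H_ideal R n P\<^esub>}"

end

(* Write C for the completion at a maximal ideal P. In a one-dimensional Noetherian domain every
   nonzero ideal I contains t P^k for some k and some t outside P (Noetherian induction). Since t
   becomes a unit in C, all passages between R and C reduce to the contraction of an ideal of R
   containing a power of P, namely the ideal of all elements that some element outside P multiplies into I;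
   an element of R lies in I as soon as it lies in this localised ideal for every P. Generators
   x^n - 1 of H_n^P, with x a unit, lie in the extension of any n-congruing ideal, hence ker pr_n is
   contained in it. Conversely ker pr_n is n-congruing: an element a outside P is a unit of C, and
   for a in P some power of a lies in H_n^P; a common exponent exists because H_n^P is the unit ideal
   unless R/P has at most n + 1 elements. *)

theory Submission
  imports Defs
begin

section \<open>Powers of an ideal\<close>

locale adic = cring R + P: ideal P R for R (structure) and P
begin

abbreviation pw :: "nat \<Rightarrow> 'a set" where "pw k \<equiv> ideal_pow R P k"
abbreviation C where "C \<equiv> completion R P"
abbreviation emb where "emb \<equiv> compl_map R P"

lemma pw_0 [simp]: "pw 0 = carrier R"
  by (simp add: ideal_pow_def)

lemma pw_Suc: "pw (Suc k) = P \<cdot> pw k"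
  by (simp add: ideal_pow_def)

lemma ideal_pw: "ideal (pw k) R"
  by (induction k) (simp_all add: pw_Suc oneideal ideal_prod_is_ideal P.is_ideal)

lemma pw_carr: "a \<in> pw k \<Longrightarrow> a \<in> carrier R"
  using ideal.Icarr[OF ideal_pw] .

lemma pw_1: "pw 1 = P"
  using pw_Suc[of 0] ideal_prod_one[OF P.is_ideal] by simp

lemma pw_antimono: "k \<le> l \<Longrightarrow> pw l \<subseteq> pw k"
proof (induction rule: dec_induct)
  case (step l)
  then show ?case
    using ideal_prod_inter[OF P.is_ideal ideal_pw[of l]] by (auto simp: pw_Suc)
qed simp

lemma pw_add: "pw (j + k) = pw j \<cdot> pw k"
proof (induction j)
  case 0
  show ?case
    using ideal_prod_commute[OF oneideal ideal_pw] ideal_prod_one[OF ideal_pw] by simp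
next
  case (Suc j)
  then show ?case by (simp add: pw_Suc ideal_prod_assoc P.is_ideal ideal_pw)
qed

lemma pw_power: "a \<in> P \<Longrightarrow> a [^] k \<in> pw k"
proof (induction k)
  case (Suc k)
  then have "a \<otimes> a [^] k \<in> P \<cdot> pw k" by (intro ideal_prod.prod) auto
  then show ?case using Suc.prems nat_pow_Suc2 by (simp add: pw_Suc P.Icarr)
qed simp

text \<open>An element of \<open>pw (j + k)\<close> is a finite sum of products of some
  \<open>i\<close> in \<open>pw j\<close> and \<open>x\<close> in \<open>pw k\<close>. Division by
  \<open>b\<close> is applied to \<open>x\<close> alone and \<open>i\<close> is carried into the
  quotient, which therefore stays in \<open>pw j\<close>. This control of the order makes series of
  quotients converge in the completion.\<close>

lemma pw_divide:
  assumes t: "t \<in> carrier R" and b: "b \<in> carrier R"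
    and sub: "\<And>d. d \<in> pw k \<Longrightarrow> \<exists>e\<in>carrier R. t \<otimes> d = b \<otimes> e"
    and d: "d \<in> pw (j + k)"
  shows "\<exists>e\<in>pw j. t \<otimes> d = b \<otimes> e"
proof -
  interpret j: ideal "pw j" R by (rule ideal_pw)
  from d have "d \<in> pw j \<cdot> pw k" by (simp add: pw_add)
  then show ?thesis
  proof (induction d rule: ideal_prod.induct)
    case (prod i x)
    then obtain e where e: "e \<in> carrier R" "t \<otimes> x = b \<otimes> e" using sub by blast
    have c: "i \<in> carrier R" "x \<in> carrier R" using prod pw_carr by auto
    have "t \<otimes> (i \<otimes> x) = i \<otimes> (t \<otimes> x)" using c t by (simp add: m_lcomm)
    also have "\<dots> = b \<otimes> (i \<otimes> e)" using c b e by (simp add: m_lcomm)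
    finally show ?case using j.I_r_closed[OF prod(1) e(1)] by blast
  next
    case (sum x y)
    then obtain e f where e: "e \<in> pw j" "t \<otimes> x = b \<otimes> e"
      and f: "f \<in> pw j" "t \<otimes> y = b \<otimes> f" by blast
    have "x \<in> carrier R" "y \<in> carrier R"
      using sum(1,2) ideal_prod_in_carrier[OF ideal_pw ideal_pw] by blast+
    then have "t \<otimes> (x \<oplus> y) = b \<otimes> (e \<oplus> f)"
      using t b e f j.Icarr by (simp add: r_distr)
    then show ?case using j.a_closed[OF e(1) f(1)] by blast
  qed
qed


section \<open>The completion by coherent sequences of representatives\<close>

text \<open>One representative in \<open>R\<close> is kept per level, and the jump from level
  \<open>k\<close> to \<open>Suc k\<close> is controlled modulo the coarser \<open>pw k\<close>
  only. Computations in the completion thereby become termwise computations in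
  \<open>R\<close>.\<close>

definition coh :: "(nat \<Rightarrow> 'a) \<Rightarrow> bool" where
  "coh s \<longleftrightarrow> (\<forall>k. s k \<in> carrier R \<and> s (Suc k) \<ominus> s k \<in> pw k)"

definition cl :: "(nat \<Rightarrow> 'a) \<Rightarrow> nat \<Rightarrow> 'a set" where
  "cl s = (\<lambda>k. pw k +> s k)"

lemma pw_zero: "\<zero> \<in> pw k"
  using additive_subgroup.zero_closed[OF ideal.axioms(1)[OF ideal_pw]] .

lemma pw_minus_self: "a \<in> carrier R \<Longrightarrow> a \<ominus> a \<in> pw k"
  using r_neg[of a] pw_zero[of k] by (simp add: a_minus_def)

lemma coh_carr: "coh s \<Longrightarrow> s k \<in> carrier R"
  by (simp add: coh_def)

lemma coset_eq_iff:
  "a \<in> carrier R \<Longrightarrow> b \<in> carrier R \<Longrightarrow> pw k +> a = pw k +> b \<longleftrightarrow> a \<ominus> b \<in> pw k"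
  using quotient_eq_iff_same_a_r_cos[OF ideal_pw] by blast

lemma ideal_telescope:
  assumes "ideal I R" "a \<in> carrier R" "b \<in> carrier R" "c \<in> carrier R"
    "a \<ominus> b \<in> I" "b \<ominus> c \<in> I"
  shows "a \<ominus> c \<in> I"
proof -
  have "a \<ominus> c = (a \<ominus> b) \<oplus> (b \<ominus> c)" using assms by algebra
  then show ?thesis using assms by (simp add: additive_subgroup.a_closed ideal.axioms(1))
qed

lemma coh_diff: assumes "coh s" "k \<le> l" shows "s l \<ominus> s k \<in> pw k"
  using assms(2)
proof (induction rule: dec_induct)
  case base
  then show ?case using coh_carr[OF assms(1)] by (simp add: pw_minus_self)
next
  case (step l)
  have "s (Suc l) \<ominus> s l \<in> pw k"
    using assms(1) pw_antimono[of k l] step(1) by (auto simp: coh_def)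
  then show ?case
    using ideal_telescope[OF ideal_pw] step coh_carr[OF assms(1)] by blast
qed

lemma cl_eq_iff: "coh s \<Longrightarrow> coh t \<Longrightarrow> cl s = cl t \<longleftrightarrow> (\<forall>k. s k \<ominus> t k \<in> pw k)"
  by (simp add: cl_def fun_eq_iff coset_eq_iff coh_carr)

text \<open>The finer coset of \<open>a\<close> always lies in the coarser coset of
  \<open>a\<close>, so the inclusion says that the coarser cosets of \<open>a\<close> and
  \<open>b\<close> meet and hence coincide. It translates the compatibility condition of the
  completion into that of \<open>coh\<close>.\<close>

lemma coset_subset_iff:
  assumes "a \<in> carrier R" "b \<in> carrier R"
  shows "pw (Suc k) +> a \<subseteq> pw k +> b \<longleftrightarrow> a \<ominus> b \<in> pw k"
proof -
  interpret k: ideal "pw k" R by (rule ideal_pw)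
  interpret Sk: ideal "pw (Suc k)" R by (rule ideal_pw)
  have sub: "pw (Suc k) +> a \<subseteq> pw k +> a"
    using pw_antimono[of k "Suc k"] by (auto simp: a_r_coset_def')
  show ?thesis
  proof
    assume "pw (Suc k) +> a \<subseteq> pw k +> b"
    then have "a \<in> pw k +> b" using Sk.a_rcos_self[OF assms(1)] by blast
    then have "pw k +> b = pw k +> a"
      using a_repr_independence[OF _ assms(2) k.a_subgroup] by blast
    then show "a \<ominus> b \<in> pw k" using coset_eq_iff assms by metis
  next
    assume "a \<ominus> b \<in> pw k"
    then show "pw (Suc k) +> a \<subseteq> pw k +> b" using sub coset_eq_iff assms by metis
  qed
qed

lemma quot_carrier: "carrier (R Quot pw k) = {pw k +> a | a. a \<in> carrier R}"
  by (auto simp: FactRing_def A_RCOSETS_def')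

lemma carrier_C: "carrier C = {cl s | s. coh s}"
proof (intro equalityI subsetI)
  fix x assume x: "x \<in> carrier C"
  then have "\<forall>k. \<exists>a\<in>carrier R. x k = pw k +> a"
    unfolding completion_def by (simp add: quot_carrier) blast
  then obtain s where s: "\<And>k. s k \<in> carrier R" "\<And>k. x k = pw k +> s k" by metis
  have "\<And>k. x (Suc k) \<subseteq> x k" using x by (simp add: completion_def)
  then have "coh s" using s by (simp add: coh_def coset_subset_iff)
  moreover have "x = cl s" using s by (simp add: cl_def fun_eq_iff)
  ultimately show "x \<in> {cl s | s. coh s}" by blast
next
  fix x assume "x \<in> {cl s | s. coh s}"
  then obtain s where s: "coh s" "x = cl s" by blast
  have "x (Suc k) \<subseteq> x k" for k
    using s by (simp add: cl_def coset_subset_iff coh_def)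
  then show "x \<in> carrier C"
    using s coh_carr by (auto simp: completion_def quot_carrier cl_def)
qed

lemma C_cases: assumes "x \<in> carrier C" obtains s where "coh s" "x = cl s"
  using assms by (auto simp: carrier_C)

lemma cl_closed: "coh s \<Longrightarrow> cl s \<in> carrier C"
  by (auto simp: carrier_C)

lemma coh_const: "a \<in> carrier R \<Longrightarrow> coh (\<lambda>_. a)"
  by (simp add: coh_def pw_minus_self)

lemma coh_add: assumes "coh s" "coh t" shows "coh (\<lambda>k. s k \<oplus> t k)"
  unfolding coh_def
proof (intro allI conjI)
  fix k
  note c = coh_carr[OF assms(1)] coh_carr[OF assms(2)]
  have "s (Suc k) \<oplus> t (Suc k) \<ominus> (s k \<oplus> t k) = (s (Suc k) \<ominus> s k) \<oplus> (t (Suc k) \<ominus> t k)"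
    using c[of k] c[of "Suc k"] by algebra
  then show "s (Suc k) \<oplus> t (Suc k) \<ominus> (s k \<oplus> t k) \<in> pw k"
    using assms by (simp add: coh_def additive_subgroup.a_closed[OF ideal.axioms(1)[OF ideal_pw]])
qed (simp add: coh_carr assms)

lemma coh_inv: assumes "coh s" shows "coh (\<lambda>k. \<ominus> s k)"
  unfolding coh_def
proof (intro allI conjI)
  fix k
  note c = coh_carr[OF assms(1)]
  have "\<ominus> s (Suc k) \<ominus> \<ominus> s k = \<ominus> (s (Suc k) \<ominus> s k)"
    using c[of k] c[of "Suc k"] by algebra
  then show "\<ominus> s (Suc k) \<ominus> \<ominus> s k \<in> pw k"
    using assms by (simp add: coh_def additive_subgroup.a_inv_closed[OF ideal.axioms(1)[OF ideal_pw]])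
qed (simp add: coh_carr assms)

lemma coh_mult: assumes "coh s" "coh t" shows "coh (\<lambda>k. s k \<otimes> t k)"
  unfolding coh_def
proof (intro allI conjI)
  fix k
  note c = coh_carr[OF assms(1)] coh_carr[OF assms(2)]
  interpret k: ideal "pw k" R by (rule ideal_pw)
  have "s (Suc k) \<otimes> t (Suc k) \<ominus> s k \<otimes> t k
      = (s (Suc k) \<ominus> s k) \<otimes> t (Suc k) \<oplus> s k \<otimes> (t (Suc k) \<ominus> t k)"
    using c[of k] c[of "Suc k"] by algebra
  then show "s (Suc k) \<otimes> t (Suc k) \<ominus> s k \<otimes> t k \<in> pw k"
    using assms c by (simp add: coh_def k.I_l_closed k.I_r_closed)
qed (simp add: coh_carr assms)

lemma cl_mult: "coh s \<Longrightarrow> coh t \<Longrightarrow> cl s \<otimes>\<^bsub>C\<^esub> cl t = cl (\<lambda>k. s k \<otimes> t k)"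
  by (simp add: completion_def cl_def FactRing_def ideal.rcoset_mult_add[OF ideal_pw] coh_carr)

lemma cl_add: "coh s \<Longrightarrow> coh t \<Longrightarrow> cl s \<oplus>\<^bsub>C\<^esub> cl t = cl (\<lambda>k. s k \<oplus> t k)"
  by (simp add: completion_def cl_def FactRing_def coh_carr
      abelian_subgroup.a_rcos_sum[OF abelian_subgroupI3[OF ideal.axioms(1)[OF ideal_pw] abelian_group_axioms]])

lemma cl_one: "\<one>\<^bsub>C\<^esub> = cl (\<lambda>_. \<one>)"
  by (simp add: completion_def cl_def FactRing_def)

lemma cl_zero: "\<zero>\<^bsub>C\<^esub> = cl (\<lambda>_. \<zero>)"
  using additive_subgroup.a_subset[OF ideal.axioms(1)[OF ideal_pw]]
  by (simp add: completion_def cl_def FactRing_def)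

lemma cring_C: "cring C"
proof (rule cringI)
  note [simp] = coh_add coh_mult coh_const coh_inv cl_closed cl_add cl_mult cl_one cl_zero coh_carr
  show "abelian_group C"
  proof (rule abelian_groupI)
    fix x assume "x \<in> carrier C"
    then obtain s where s: "coh s" "x = cl s" by (rule C_cases)
    then have "cl (\<lambda>k. \<ominus> s k) \<oplus>\<^bsub>C\<^esub> x = \<zero>\<^bsub>C\<^esub>" by (simp add: l_neg)
    then show "\<exists>y\<in>carrier C. y \<oplus>\<^bsub>C\<^esub> x = \<zero>\<^bsub>C\<^esub>" using s(1) coh_inv cl_closed by blast
  qed (auto elim!: C_cases simp: a_assoc, auto simp: a_comm)
  show "comm_monoid C"
    by (rule comm_monoidI) (auto elim!: C_cases simp: m_assoc, auto simp: m_comm)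
qed (auto elim!: C_cases simp: coh_add coh_mult cl_closed cl_add cl_mult l_distr coh_carr)

sublocale C: cring C by (rule cring_C)

lemma cl_inv: "coh s \<Longrightarrow> \<ominus>\<^bsub>C\<^esub> cl s = cl (\<lambda>k. \<ominus> s k)"
  by (rule C.minus_equality)
    (simp_all add: cl_add cl_closed cl_zero coh_inv l_neg coh_carr)

lemma cl_minus: "coh s \<Longrightarrow> coh t \<Longrightarrow> cl s \<ominus>\<^bsub>C\<^esub> cl t = cl (\<lambda>k. s k \<ominus> t k)"
  by (simp add: a_minus_def cl_inv cl_add coh_inv)

lemma coh_minus: "coh s \<Longrightarrow> coh t \<Longrightarrow> coh (\<lambda>k. s k \<ominus> t k)"
  by (simp add: a_minus_def coh_add coh_inv)

lemma coh_pow: "coh s \<Longrightarrow> coh (\<lambda>k. s k [^] (n::nat))"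
  by (induction n) (simp_all add: coh_const coh_mult)

lemma cl_pow: "coh s \<Longrightarrow> cl s [^]\<^bsub>C\<^esub> (n::nat) = cl (\<lambda>k. s k [^] n)"
  by (induction n) (simp_all add: cl_one cl_mult coh_pow)

lemma emb_cl: "emb a = cl (\<lambda>_. a)"
  by (simp add: compl_map_def cl_def)

lemma emb_hom: "ring_hom_ring R C emb"
  by (rule ring_hom_ringI)
    (simp_all add: emb_cl cl_closed coh_const cl_mult cl_add cl_one ring_axioms C.ring_axioms)

sublocale emb: ring_hom_ring R C emb by (rule emb_hom)

section \<open>Extension and contraction of ideals between the ring and its completion\<close>

lemma cl_subset_iff:
  assumes L: "ideal L R" "pw k \<subseteq> L" and s: "coh s"
  shows "cl s k \<subseteq> L \<longleftrightarrow> s k \<in> L"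
proof
  interpret k: ideal "pw k" R by (rule ideal_pw)
  show "cl s k \<subseteq> L \<Longrightarrow> s k \<in> L"
    using k.a_rcos_self[OF coh_carr[OF s]] by (auto simp: cl_def)
  interpret L: ideal L R by (rule L)
  show "s k \<in> L \<Longrightarrow> cl s k \<subseteq> L"
    using L(2) by (auto simp: cl_def a_r_coset_def')
qed

text \<open>This is the preimage of \<open>L / P^k\<close> under the projection of the completion to
  level \<open>k\<close>. Because \<open>L\<close> contains \<open>pw k\<close>, membership can be
  tested on any representative, so closure is inherited from \<open>L\<close>.\<close>

lemma lift_ideal:
  assumes L: "ideal L R" "pw k \<subseteq> L"
  shows "ideal {x \<in> carrier C. x k \<subseteq> L} C" (is "ideal ?M C")
proof -
  interpret L: ideal L R by (rule L)
  note [simp] = cl_subset_iff[OF L] coh_add coh_mult coh_inv coh_const cl_closed coh_carr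
  show ?thesis
  proof (rule idealI[OF C.ring_axioms])
    show "subgroup ?M (add_monoid C)"
    proof
      fix x assume "x \<in> ?M"
      then obtain s where s: "coh s" "x = cl s" "s k \<in> L" by (auto elim!: C_cases)
      show "inv\<^bsub>add_monoid C\<^esub> x \<in> ?M"
        unfolding a_inv_def[symmetric] using s by (simp add: cl_inv)
    next
      show "\<one>\<^bsub>add_monoid C\<^esub> \<in> ?M" by (simp add: cl_zero)
    qed (auto elim!: C_cases simp: cl_add del: subsetI)
  qed (auto elim!: C_cases simp: cl_mult L.I_l_closed L.I_r_closed del: subsetI)
qed

lemma ideal_compl_ideal: "ideal I R \<Longrightarrow> ideal (compl_ideal R P I) C"
  unfolding compl_ideal_def by (rule C.genideal_ideal) (auto dest: ideal.Icarr)

lemma emb_compl_ideal: "ideal I R \<Longrightarrow> a \<in> I \<Longrightarrow> emb a \<in> compl_ideal R P I"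
  unfolding compl_ideal_def
  by (rule subsetD[OF C.genideal_self]) (auto dest: ideal.Icarr)

text \<open>The preimage of \<open>L\<close> at level \<open>k\<close> is an ideal of
  \<open>C\<close> containing the image of \<open>I\<close>, hence the whole extension of
  \<open>I\<close>; on constant sequences, membership in it means membership in
  \<open>L\<close>.\<close>

lemma compl_ideal_contract:
  assumes L: "ideal L R" "pw k \<subseteq> L" and I: "I \<subseteq> L"
    and a: "a \<in> carrier R" "emb a \<in> compl_ideal R P I"
  shows "a \<in> L"
proof -
  interpret L: ideal L R by (rule L)
  have "compl_ideal R P I \<subseteq> {x \<in> carrier C. x k \<subseteq> L}"
    unfolding compl_ideal_def
    by (rule C.genideal_minimal[OF lift_ideal[OF L]], rule image_subsetI)
      (use I L.Icarr in \<open>simp add: subset_iff[of I] emb_cl cl_subset_iff[OF L] coh_const cl_closed\<close>)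
  then show ?thesis
    using a by (auto simp: emb_cl cl_subset_iff[OF L] coh_const)
qed

text \<open>Writing an element of the kernel of the projection to \<open>R/P\<^sup>k\<close> as a sum of elements of
  \<open>P\<^sup>j\<^sup>+\<^sup>k\<close>, multiplication by \<open>t\<close> turns the \<open>j\<close>-th summand into \<open>b\<close> times an element of
  \<open>P\<^sup>j\<close>, so that the quotients by \<open>b\<close> again sum up to an element of the completion.\<close>
lemma kernel_subset_compl_ideal:
  assumes I: "ideal I R" "b \<in> I" and t: "t \<in> carrier R" "emb t \<in> Units C"
    and sub: "\<And>d. d \<in> pw k \<Longrightarrow> \<exists>e\<in>carrier R. t \<otimes> d = b \<otimes> e"
    and x: "x \<in> carrier C" "x k = pw k"
  shows "x \<in> compl_ideal R P I"
proof -
  have b: "b \<in> carrier R" using ideal.Icarr[OF I] .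
  obtain s where s: "coh s" "x = cl s" using x(1) by (rule C_cases)
  note sc = coh_carr[OF s(1)]
  interpret k: ideal "pw k" R by (rule ideal_pw)
  have "s k \<in> pw k" using x(2) s k.a_rcos_self[OF sc, of k] by (simp add: cl_def)
  then obtain e0 where e0: "e0 \<in> carrier R" "t \<otimes> s k = b \<otimes> e0" using sub by blast
  have "\<exists>e\<in>pw j. t \<otimes> (s (Suc (j + k)) \<ominus> s (j + k)) = b \<otimes> e" for j
    by (rule pw_divide[OF t(1) b sub]) (use s(1) in \<open>auto simp: coh_def\<close>)
  then obtain e where e: "\<And>j. e j \<in> pw j"
    "\<And>j. t \<otimes> (s (Suc (j + k)) \<ominus> s (j + k)) = b \<otimes> e j" by metis
  note ec = pw_carr[OF e(1)]
  define y where "y = rec_nat e0 (\<lambda>j r. r \<oplus> e j)"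
  have y0: "y 0 = e0" and yS: "\<And>j. y (Suc j) = y j \<oplus> e j" by (simp_all add: y_def)
  have yc: "y j \<in> carrier R" for j by (induction j) (simp_all add: y0 yS e0 ec)
  have "y (Suc j) \<ominus> y j = e j" for j using yc[of j] ec[of j] unfolding yS by algebra
  then have cy: "coh y" using yc e(1) by (simp add: coh_def)
  have ty: "t \<otimes> s (j + k) = b \<otimes> y j" for j
  proof (induction j)
    case (Suc j)
    have "t \<otimes> s (Suc (j + k)) = t \<otimes> s (j + k) \<oplus> t \<otimes> (s (Suc (j + k)) \<ominus> s (j + k))"
      using t(1) sc[of "Suc (j + k)"] sc[of "j + k"] by algebra
    also have "\<dots> = b \<otimes> y (Suc j)" using Suc e(2) yc ec b by (simp add: yS r_distr)
    finally show ?case by simp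
  qed (simp add: y0 e0)
  have "emb t \<otimes>\<^bsub>C\<^esub> x = emb b \<otimes>\<^bsub>C\<^esub> cl y"
  proof -
    \<comment> \<open>\<open>y\<close> was built from the sequence \<open>s\<close> shifted by
      \<open>k\<close>. The shift is harmless, since \<open>s (j + k)\<close> and \<open>s j\<close>
      agree modulo \<open>pw j\<close>.\<close>
    have "t \<otimes> s j \<ominus> b \<otimes> y j \<in> pw j" for j
    proof -
      interpret j: ideal "pw j" R by (rule ideal_pw)
      have "t \<otimes> s j \<ominus> b \<otimes> y j = \<ominus> (t \<otimes> (s (j + k) \<ominus> s j))"
        unfolding ty[symmetric] using t(1) sc[of "j + k"] sc[of j] by algebra
      then show ?thesis using coh_diff[OF s(1), of j "j + k"] t(1) j.I_l_closed by simp
    qed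
    then show ?thesis
      using t(1) b s cy by (simp add: emb_cl cl_mult coh_const cl_eq_iff coh_mult)
  qed
  also have "\<dots> \<in> compl_ideal R P I"
    using ideal.I_r_closed[OF ideal_compl_ideal emb_compl_ideal] I cl_closed[OF cy] by blast
  finally have "inv\<^bsub>C\<^esub> emb t \<otimes>\<^bsub>C\<^esub> (emb t \<otimes>\<^bsub>C\<^esub> x) \<in> compl_ideal R P I"
    using ideal.I_l_closed[OF ideal_compl_ideal] I(1) t(2) by blast
  then show ?thesis using t x(1) by (simp add: C.m_assoc[symmetric])
qed

text \<open>An element of \<open>C\<close> is approximated by its representative \<open>s k\<close>
  in \<open>R\<close>, whose exponent \<open>N\<close> is taken. Passing from \<open>s\<close> to
  the constant \<open>s k\<close> changes the value of the congruing expression by an element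
  trivial at level \<open>k\<close>, and such elements lie in the extension of \<open>I\<close> by
  \<open>kernel_subset_compl_ideal\<close>.\<close>

lemma n_congruing_compl_ideal:
  assumes I: "n_congruing R n I" "b \<in> I" and t: "t \<in> carrier R" "emb t \<in> Units C"
    and sub: "\<And>d. d \<in> pw k \<Longrightarrow> \<exists>e\<in>carrier R. t \<otimes> d = b \<otimes> e"
  shows "n_congruing C n (compl_ideal R P I)"
proof -
  have iI: "ideal I R" using I(1) by (simp add: n_congruing_def)
  interpret J: ideal "compl_ideal R P I" C by (rule ideal_compl_ideal[OF iI])
  have "\<exists>N::nat. x [^]\<^bsub>C\<^esub> N \<otimes>\<^bsub>C\<^esub> (x [^]\<^bsub>C\<^esub> n \<ominus>\<^bsub>C\<^esub> \<one>\<^bsub>C\<^esub>) \<in> compl_ideal R P I" if "x \<in> carrier C" for x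
  proof -
    from that obtain s where s: "coh s" "x = cl s" by (rule C_cases)
    note sc = coh_carr[OF s(1)]
    obtain N :: nat where N: "s k [^] N \<otimes> (s k [^] n \<ominus> \<one>) \<in> I"
      using I(1) sc[of k] unfolding n_congruing_def by blast
    let ?f = "\<lambda>r. r [^] N \<otimes> (r [^] n \<ominus> \<one>)"
    have z: "x [^]\<^bsub>C\<^esub> N \<otimes>\<^bsub>C\<^esub> (x [^]\<^bsub>C\<^esub> n \<ominus>\<^bsub>C\<^esub> \<one>\<^bsub>C\<^esub>) = cl (\<lambda>j. ?f (s j))"
      using s by (simp add: cl_pow cl_mult cl_minus cl_one coh_pow coh_minus coh_const)
    have cf: "coh (\<lambda>j. ?f (s j))"
      using s by (simp add: coh_pow coh_minus coh_const coh_mult)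
    have fc: "?f (s j) \<in> carrier R" for j using sc[of j] by simp
    have "cl (\<lambda>j. ?f (s j)) \<ominus>\<^bsub>C\<^esub> emb (?f (s k)) \<in> compl_ideal R P I"
    proof (rule kernel_subset_compl_ideal[OF iI I(2) t sub])
      show "cl (\<lambda>j. ?f (s j)) \<ominus>\<^bsub>C\<^esub> emb (?f (s k)) \<in> carrier C"
        by (intro C.minus_closed cl_closed[OF cf] emb.hom_closed fc)
      interpret k: ideal "pw k" R by (rule ideal_pw)
      have "?f (s k) \<ominus> ?f (s k) = \<zero>" using r_neg[OF fc] by (simp add: a_minus_def)
      then show "(cl (\<lambda>j. ?f (s j)) \<ominus>\<^bsub>C\<^esub> emb (?f (s k))) k = pw k"
        unfolding emb_cl cl_minus[OF cf coh_const[OF fc]]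
        by (simp add: cl_def k.a_subset)
    qed
    then have "(cl (\<lambda>j. ?f (s j)) \<ominus>\<^bsub>C\<^esub> emb (?f (s k))) \<oplus>\<^bsub>C\<^esub> emb (?f (s k)) \<in> compl_ideal R P I"
      by (rule J.a_closed[OF _ emb_compl_ideal[OF iI N]])
    moreover have "(u \<ominus>\<^bsub>C\<^esub> v) \<oplus>\<^bsub>C\<^esub> v = u" if "u \<in> carrier C" "v \<in> carrier C" for u v
      using that by (simp add: a_minus_def C.a_assoc C.l_neg)
    from this[OF cl_closed[OF cf] emb.hom_closed[OF fc[of k]]]
    have "(cl (\<lambda>j. ?f (s j)) \<ominus>\<^bsub>C\<^esub> emb (?f (s k))) \<oplus>\<^bsub>C\<^esub> emb (?f (s k)) = cl (\<lambda>j. ?f (s j))" .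
    ultimately have "cl (\<lambda>j. ?f (s j)) \<in> compl_ideal R P I" by simp
    then show ?thesis unfolding z[symmetric] by (rule exI)
  qed
  then show ?thesis using J.is_ideal by (simp add: n_congruing_def)
qed

section \<open>The ideal generated by the n-th powers of units minus one\<close>

lemma ideal_H_ideal: "ideal (H_ideal R n P) C"
  unfolding H_ideal_def by (rule C.genideal_ideal) blast

lemma H_ideal_gen: "x \<in> Units C \<Longrightarrow> x [^]\<^bsub>C\<^esub> n \<ominus>\<^bsub>C\<^esub> \<one>\<^bsub>C\<^esub> \<in> H_ideal R n P"
  unfolding H_ideal_def by (rule subsetD[OF C.genideal_self]) blast+

lemma emb_power_minus_one:
  "r \<in> carrier R \<Longrightarrow> emb (r [^] (n::nat) \<ominus> \<one>) = emb r [^]\<^bsub>C\<^esub> n \<ominus>\<^bsub>C\<^esub> \<one>\<^bsub>C\<^esub>"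
  by (simp add: emb_cl cl_pow coh_const cl_one cl_minus)

lemma n_congruing_emb:
  assumes "n_congruing C n J" "a \<in> carrier R"
  shows "\<exists>N::nat. emb (a [^] N \<otimes> (a [^] n \<ominus> \<one>)) \<in> J"
proof -
  obtain N :: nat where "emb a [^]\<^bsub>C\<^esub> N \<otimes>\<^bsub>C\<^esub> (emb a [^]\<^bsub>C\<^esub> n \<ominus>\<^bsub>C\<^esub> \<one>\<^bsub>C\<^esub>) \<in> J"
    using assms emb.hom_closed[OF assms(2)] unfolding n_congruing_def by blast
  then have "emb (a [^] N) \<otimes>\<^bsub>C\<^esub> emb (a [^] n \<ominus> \<one>) \<in> J"
    using assms(2) by (simp only: emb_power_minus_one emb.hom_nat_pow)
  moreover have "emb (a [^] N) \<otimes>\<^bsub>C\<^esub> emb (a [^] n \<ominus> \<one>) = emb (a [^] N \<otimes> (a [^] n \<ominus> \<one>))"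
    using assms(2) by (intro emb.hom_mult[symmetric]) auto
  ultimately show ?thesis by auto
qed

lemma pr_comp_eq_zero_iff:
  assumes "a \<in> carrier R"
  shows "pr_comp R n P a = \<zero>\<^bsub>C Quot H_ideal R n P\<^esub> \<longleftrightarrow> emb a \<in> H_ideal R n P"
proof -
  interpret H: ideal "H_ideal R n P" C by (rule ideal_H_ideal)
  have "H_ideal R n P +>\<^bsub>C\<^esub> emb a = H_ideal R n P \<longleftrightarrow> emb a \<in> H_ideal R n P"
    using H.rcos_const_imp_mem[OF emb.hom_closed[OF assms]] C.a_rcos_zero[OF H.is_ideal] by blast
  then show ?thesis by (simp add: pr_comp_def FactRing_def)
qed

end

section \<open>Maximal ideals: units of the completion, localised ideals, residue fields\<close>

locale maximal_adic = adic R P + maximal: maximalideal P R for R (structure) and P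
begin

lemma mod_inverse:
  assumes "t \<in> carrier R" "t \<notin> P"
  obtains r where "r \<in> carrier R" "t \<otimes> r \<ominus> \<one> \<in> P"
proof -
  interpret Q: field "R Quot P" by (rule maximal.quotient_is_field[OF is_cring])
  have "P +> t \<in> carrier (R Quot P)" "P +> t \<noteq> \<zero>\<^bsub>R Quot P\<^esub>"
    using assms P.rcos_const_imp_mem by (auto simp: FactRing_def A_RCOSETS_def')
  then have "P +> t \<in> Units (R Quot P)" by (simp add: Q.field_Units)
  then obtain y where y: "y \<in> carrier (R Quot P)" "(P +> t) \<otimes>\<^bsub>R Quot P\<^esub> y = \<one>\<^bsub>R Quot P\<^esub>"
    by (auto simp: Units_def)
  then obtain r where r: "r \<in> carrier R" "y = P +> r"
    by (auto simp: FactRing_def A_RCOSETS_def')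
  have "P +> (t \<otimes> r) = P +> \<one>"
    using y r assms by (simp add: FactRing_def P.rcoset_mult_add)
  then show ?thesis
    using that r assms quotient_eq_iff_same_a_r_cos[OF P.is_ideal] by simp
qed

lemma mult_notin: "s \<in> carrier R \<Longrightarrow> t \<in> carrier R \<Longrightarrow> s \<notin> P \<Longrightarrow> t \<notin> P \<Longrightarrow> s \<otimes> t \<notin> P"
  using primeideal.I_prime[OF maximalideal_prime[OF maximal.is_maximalideal]] by blast

lemma one_notin: "\<one> \<notin> P"
  using maximal.I_notcarr P.one_imp_carrier by blast

lemma pow_notin: "t \<in> carrier R \<Longrightarrow> t \<notin> P \<Longrightarrow> t [^] (n::nat) \<notin> P"
  by (induction n) (simp_all add: one_notin mult_notin)

text \<open>Inverses of \<open>t\<close> modulo every \<open>pw k\<close> are built by induction on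
  \<open>k\<close>. They form a coherent sequence because inverses modulo \<open>pw k\<close> are
  unique.\<close>

lemma Units_emb:
  assumes t: "t \<in> carrier R" "t \<notin> P"
  shows "emb t \<in> Units C"
proof -
  obtain r where r: "r \<in> carrier R" "t \<otimes> r \<ominus> \<one> \<in> P" by (rule mod_inverse[OF t])
  have "\<exists>s\<in>carrier R. t \<otimes> s \<ominus> \<one> \<in> pw k" for k
  proof (induction k)
    case 0
    then show ?case using t by auto
  next
    case (Suc k)
    then obtain s where s: "s \<in> carrier R" "t \<otimes> s \<ominus> \<one> \<in> pw k" by blast
    \<comment> \<open>If \<open>r\<close> inverts \<open>t\<close> modulo \<open>P\<close> and
      \<open>s\<close> inverts it modulo \<open>pw k\<close>, the product of the two errors lies in
      \<open>pw (Suc k)\<close> and is, up to sign, the error of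
      \<open>r \<oplus> s \<ominus> r \<otimes> (t \<otimes> s)\<close>.\<close>
    have "(t \<otimes> r \<ominus> \<one>) \<otimes> (t \<otimes> s \<ominus> \<one>) \<in> pw (Suc k)"
      unfolding pw_Suc using r(2) s(2) by (rule ideal_prod.prod)
    moreover have "(t \<otimes> r \<ominus> \<one>) \<otimes> (t \<otimes> s \<ominus> \<one>) = \<ominus> (t \<otimes> (r \<oplus> s \<ominus> r \<otimes> (t \<otimes> s)) \<ominus> \<one>)"
      using t r(1) s(1) by algebra
    ultimately have "\<ominus> (\<ominus> (t \<otimes> (r \<oplus> s \<ominus> r \<otimes> (t \<otimes> s)) \<ominus> \<one>)) \<in> pw (Suc k)"
      using additive_subgroup.a_inv_closed[OF ideal.axioms(1)[OF ideal_pw]] by simp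
    then have "t \<otimes> (r \<oplus> s \<ominus> r \<otimes> (t \<otimes> s)) \<ominus> \<one> \<in> pw (Suc k)"
      using t r(1) s(1) by simp
    then show ?case using t r(1) s(1) by (intro bexI[of _ "r \<oplus> s \<ominus> r \<otimes> (t \<otimes> s)"]) auto
  qed
  then obtain s where s: "\<And>k. s k \<in> carrier R" "\<And>k. t \<otimes> s k \<ominus> \<one> \<in> pw k" by metis
  have "s (Suc k) \<ominus> s k \<in> pw k" for k
  proof -
    interpret k: ideal "pw k" R by (rule ideal_pw)
    have "t \<otimes> s (Suc k) \<ominus> \<one> \<in> pw k" using s(2) pw_antimono[of k "Suc k"] by auto
    \<comment> \<open>Uniqueness of inverses: this combination of the two errors is exactly
      \<open>s (Suc k) \<ominus> s k\<close>, so independently chosen approximations agree.\<close>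
    then have "\<ominus> (s (Suc k) \<otimes> (t \<otimes> s k \<ominus> \<one>)) \<oplus> s k \<otimes> (t \<otimes> s (Suc k) \<ominus> \<one>) \<in> pw k"
      using s k.I_l_closed by simp
    moreover have "\<ominus> (s (Suc k) \<otimes> (t \<otimes> s k \<ominus> \<one>)) \<oplus> s k \<otimes> (t \<otimes> s (Suc k) \<ominus> \<one>) = s (Suc k) \<ominus> s k"
      using t s(1)[of k] s(1)[of "Suc k"] by algebra
    ultimately show ?thesis by simp
  qed
  then have cs: "coh s" using s by (simp add: coh_def)
  have "cl s \<otimes>\<^bsub>C\<^esub> emb t = \<one>\<^bsub>C\<^esub>" "emb t \<otimes>\<^bsub>C\<^esub> cl s = \<one>\<^bsub>C\<^esub>"
    using t s cs m_comm by (simp_all add: emb_cl cl_one cl_mult coh_const cl_eq_iff coh_mult)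
  then show ?thesis using cl_closed[OF cs] t by (auto simp: Units_def)
qed

text \<open>Modulo \<open>P\<close> a unit has an inverse, so its representative cannot vanish
  there. The index is a successor because level \<open>0\<close> is taken modulo
  \<open>carrier R\<close> and carries no information.\<close>

lemma Units_notin:
  assumes "cl s \<in> Units C" "coh s"
  shows "s (Suc k) \<notin> P"
proof
  assume P: "s (Suc k) \<in> P"
  obtain x where "x \<in> carrier C" and x: "cl s \<otimes>\<^bsub>C\<^esub> x = \<one>\<^bsub>C\<^esub>"
    using assms(1) by (auto simp: Units_def)
  then obtain u where u: "coh u" "x = cl u" by (auto elim: C_cases)
  note c = coh_carr[OF assms(2), of "Suc k"] coh_carr[OF u(1), of "Suc k"]
  have "s (Suc k) \<otimes> u (Suc k) \<ominus> \<one> \<in> pw (Suc k)"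
    using x assms(2) u by (simp add: cl_one cl_mult cl_eq_iff coh_mult coh_const)
  then have "s (Suc k) \<otimes> u (Suc k) \<ominus> \<one> \<in> P"
    using pw_antimono[of 1 "Suc k"] by (auto simp: pw_1[simplified])
  then have "\<ominus> (s (Suc k) \<otimes> u (Suc k) \<ominus> \<one>) \<oplus> s (Suc k) \<otimes> u (Suc k) \<in> P"
    using P c P.I_r_closed by simp
  moreover have "\<ominus> (s (Suc k) \<otimes> u (Suc k) \<ominus> \<one>) \<oplus> s (Suc k) \<otimes> u (Suc k) = \<one>"
    using c by algebra
  ultimately show False using one_notin by simp
qed

lemma H_ideal_contract:
  assumes L: "ideal L R" "pw k \<subseteq> L"
    and gen: "\<And>r. r \<in> carrier R \<Longrightarrow> r \<notin> P \<Longrightarrow> r [^] n \<ominus> \<one> \<in> L"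
    and a: "a \<in> carrier R" "emb a \<in> H_ideal R n P"
  shows "a \<in> L"
proof -
  \<comment> \<open>The argument runs at level \<open>Suc k\<close>, since
    \<open>Units_notin\<close> needs a positive level while \<open>k\<close> may be
    \<open>0\<close>.\<close>
  have L': "pw (Suc k) \<subseteq> L" using L(2) pw_antimono[of k "Suc k"] by auto
  have "H_ideal R n P \<subseteq> {x \<in> carrier C. x (Suc k) \<subseteq> L}"
    unfolding H_ideal_def
  proof (rule C.genideal_minimal[OF lift_ideal[OF L(1) L']], safe)
    fix x assume x: "x \<in> Units C"
    then show "x [^]\<^bsub>C\<^esub> n \<ominus>\<^bsub>C\<^esub> \<one>\<^bsub>C\<^esub> \<in> carrier C" by auto
    obtain s where s: "coh s" "x = cl s" using x by (auto elim: C_cases)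
    have "s (Suc k) [^] n \<ominus> \<one> \<in> L"
      using gen coh_carr[OF s(1)] Units_notin[OF x[unfolded s(2)] s(1)] by blast
    then have "(x [^]\<^bsub>C\<^esub> n \<ominus>\<^bsub>C\<^esub> \<one>\<^bsub>C\<^esub>) (Suc k) \<subseteq> L"
      using s by (simp add: cl_pow cl_one cl_minus coh_pow coh_const cl_subset_iff[OF L(1) L'] coh_minus)
    then show "y \<in> (x [^]\<^bsub>C\<^esub> n \<ominus>\<^bsub>C\<^esub> \<one>\<^bsub>C\<^esub>) (Suc k) \<Longrightarrow> y \<in> L" for y by blast
  qed
  then show ?thesis
    using a by (auto simp: emb_cl cl_subset_iff[OF L(1) L'] coh_const)
qed

text \<open>The contraction to \<open>R\<close> of the extension of \<open>I\<close> to the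
  localisation of \<open>R\<close> at \<open>P\<close>.\<close>

definition loc :: "'a set \<Rightarrow> 'a set" where
  "loc I = {r \<in> carrier R. \<exists>s\<in>carrier R - P. s \<otimes> r \<in> I}"

lemma locI: "r \<in> carrier R \<Longrightarrow> s \<in> carrier R \<Longrightarrow> s \<notin> P \<Longrightarrow> s \<otimes> r \<in> I \<Longrightarrow> r \<in> loc I"
  by (auto simp: loc_def)

lemma locE:
  assumes "r \<in> loc I"
  obtains s where "r \<in> carrier R" "s \<in> carrier R" "s \<notin> P" "s \<otimes> r \<in> I"
  using assms by (auto simp: loc_def)

lemma ideal_loc:
  assumes "ideal I R"
  shows "ideal (loc I) R"
proof (rule idealI[OF ring_axioms])
  interpret I: ideal I R by fact
  show "subgroup (loc I) (add_monoid R)"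
  proof
    fix x y assume "x \<in> loc I" "y \<in> loc I"
    then obtain s t where s: "x \<in> carrier R" "s \<in> carrier R" "s \<notin> P" "s \<otimes> x \<in> I"
      and t: "y \<in> carrier R" "t \<in> carrier R" "t \<notin> P" "t \<otimes> y \<in> I" by (meson locE)
    have "(s \<otimes> t) \<otimes> (x \<oplus> y) = t \<otimes> (s \<otimes> x) \<oplus> s \<otimes> (t \<otimes> y)"
      using s t by (simp add: r_distr m_ac)
    also have "\<dots> \<in> I" using s t I.I_l_closed I.a_closed by simp
    finally show "x \<otimes>\<^bsub>add_monoid R\<^esub> y \<in> loc I"
      using locI[of "x \<oplus> y" "s \<otimes> t"] s t mult_notin by simp
  next
    fix x assume "x \<in> loc I"
    then obtain s where s: "x \<in> carrier R" "s \<in> carrier R" "s \<notin> P" "s \<otimes> x \<in> I" by (rule locE)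
    then show "inv\<^bsub>add_monoid R\<^esub> x \<in> loc I"
      unfolding a_inv_def[symmetric] by (intro locI[of _ s]) (simp_all add: r_minus)
  next
    show "\<one>\<^bsub>add_monoid R\<^esub> \<in> loc I"
      using one_notin I.zero_closed by (intro locI[of _ \<one>]) simp_all
  qed (auto simp: loc_def)
  show left: "x \<otimes> a \<in> loc I" if a: "a \<in> loc I" and x: "x \<in> carrier R" for a x
  proof -
    from a obtain s where s: "a \<in> carrier R" "s \<in> carrier R" "s \<notin> P" "s \<otimes> a \<in> I" by (rule locE)
    then have "s \<otimes> (x \<otimes> a) \<in> I" using x I.I_l_closed[OF s(4) x] by (simp add: m_lcomm)
    then show ?thesis using locI s x by simp
  qed
  show "a \<otimes> x \<in> loc I" if "a \<in> loc I" "x \<in> carrier R" for a x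
    using left[OF that] that by (auto elim: locE simp: m_comm)
qed

lemma subset_loc: assumes "ideal I R" shows "I \<subseteq> loc I"
proof
  fix r assume "r \<in> I"
  then show "r \<in> loc I"
    using ideal.Icarr[OF assms] one_notin by (intro locI[of r \<one>]) auto
qed

text \<open>Here both \<open>r\<close> and \<open>r [^] n \<ominus> \<one>\<close> become units of
  \<open>C\<close>, so one of the generators of the ideal is itself a unit.\<close>

lemma H_ideal_eq_carrier:
  assumes r: "r \<in> carrier R" "r \<notin> P" "r [^] n \<ominus> \<one> \<notin> P"
  shows "H_ideal R n P = carrier C"
proof -
  interpret H: ideal "H_ideal R n P" C by (rule ideal_H_ideal)
  let ?u = "emb (r [^] n \<ominus> \<one>)"
  have "?u \<in> H_ideal R n P"
    using H_ideal_gen[OF Units_emb] r by (simp add: emb_power_minus_one)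
  moreover have "?u \<in> Units C" using r by (intro Units_emb) auto
  ultimately have "\<one>\<^bsub>C\<^esub> \<in> H_ideal R n P"
    using H.I_l_closed[of ?u "inv\<^bsub>C\<^esub> ?u"] by simp
  then show ?thesis by (rule H.one_imp_carrier)
qed

text \<open>In the residue field at most \<open>n\<close> elements satisfy \<open>x^n = 1\<close>.
  Together with zero they number at most \<open>n + 1\<close>, so \<open>n + 2\<close> elements
  leave room for another one, which is lifted to \<open>R\<close>.\<close>

lemma large_residue_field:
  assumes n: "n > 0" and Q: "finite (carrier (R Quot P))" "card (carrier (R Quot P)) \<ge> n + 2"
  obtains r where "r \<in> carrier R" "r \<notin> P" "r [^] n \<ominus> \<one> \<notin> P"
proof -
  interpret Q: field "R Quot P" by (rule maximal.quotient_is_field[OF is_cring])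
  note pow = ring_hom_ring.hom_nat_pow[OF P.rcos_ring_hom_ring]
  let ?U = "insert \<zero>\<^bsub>R Quot P\<^esub> {x \<in> carrier (R Quot P). x [^]\<^bsub>R Quot P\<^esub> n = \<one>\<^bsub>R Quot P\<^esub>}"
  have "card ?U \<le> Suc (card {x \<in> carrier (R Quot P). x [^]\<^bsub>R Quot P\<^esub> n = \<one>\<^bsub>R Quot P\<^esub>})"
    using Q(1) by (simp add: card_insert_if)
  also have "\<dots> \<le> n + 1" using Q.num_roots_le_deg[OF Q(1), of n] n by simp
  also have "\<dots> < card (carrier (R Quot P))" using Q(2) by simp
  finally have "card ?U < card (carrier (R Quot P))" .
  moreover have "finite ?U" using Q(1) by simp
  ultimately have "\<not> carrier (R Quot P) \<subseteq> ?U" by (meson card_mono leD)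
  then obtain x where x: "x \<in> carrier (R Quot P)" "x \<noteq> \<zero>\<^bsub>R Quot P\<^esub>"
    "x [^]\<^bsub>R Quot P\<^esub> n \<noteq> \<one>\<^bsub>R Quot P\<^esub>" by blast
  from x(1) obtain r where r: "r \<in> carrier R" "x = P +> r"
    by (auto simp: FactRing_def A_RCOSETS_def')
  have "r \<notin> P"
    using x(2) r a_rcos_zero[OF P.is_ideal] by (auto simp: FactRing_def)
  moreover have "r [^] n \<ominus> \<one> \<notin> P"
  proof
    assume "r [^] n \<ominus> \<one> \<in> P"
    then have "P +> (r [^] n) = P +> \<one>"
      using quotient_eq_iff_same_a_r_cos[OF P.is_ideal] r by simp
    then show False using x(3) r by (simp add: pow FactRing_def)
  qed
  ultimately show ?thesis using that r by blast
qed

end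




section \<open>One-dimensional Noetherian domains\<close>

lemma (in domain) finite_roots_of_unity:
  assumes "n > 0"
  shows "finite {x \<in> carrier R. x [^] (n::nat) = \<one>}"
proof -
  let ?p = "poly_add (monom \<one> n) [\<ominus> \<one>]"
  have set: "set (monom \<one> n) \<subseteq> carrier R" "set [\<ominus> \<one>] \<subseteq> carrier R"
    by (auto simp: monom_in_carrier)
  have p: "?p \<in> carrier (poly_ring R)"
    using poly_add_is_polynomial[OF carrier_is_subring set] univ_poly_carrier by blast
  have ev: "eval ?p x = x [^] n \<ominus> \<one>" if "x \<in> carrier R" for x
    using that set by (simp add: eval_poly_add eval_monom a_minus_def del: poly_add.simps)
  \<comment> \<open>The value at zero is minus one because \<open>n\<close> is positive. It shows
    that \<open>?p\<close> is not the zero polynomial, whose representation is the empty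
    list.\<close>
  have "eval ?p \<zero> \<noteq> \<zero>"
    using assms by (simp add: ev nat_pow_zero a_minus_def del: poly_add.simps)
  then have "?p \<noteq> []" by auto
  then have "{x \<in> carrier R. x [^] n = \<one>} \<subseteq> {x. is_root ?p x}"
    by (auto simp: is_root_def ev simp del: poly_add.simps)
  then show ?thesis using finite_number_of_roots[OF p] finite_subset by blast
qed

locale dim1_noetherian_domain = noetherian_domain R for R (structure) +
  assumes prime_maximal: "primeideal Q R \<Longrightarrow> Q \<noteq> {\<zero>} \<Longrightarrow> maximalideal Q R"
begin

section \<open>Noetherian induction and passage from local to global\<close>

lemma maximal_adic: "maximalideal P R \<Longrightarrow> maximal_adic R P"
  by (simp add: maximal_adic_def adic_def maximalideal_def is_cring)

text \<open>Zorn's lemma applies because in a Noetherian ring the union of a nonempty chain of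
  ideals belongs to the chain.\<close>

lemma maximal_element:
  assumes "S \<noteq> {}" "S \<subseteq> {I. ideal I R}"
  obtains M where "M \<in> S" "\<And>Y. Y \<in> S \<Longrightarrow> M \<subseteq> Y \<Longrightarrow> Y = M"
proof -
  have "\<Union>\<C> \<in> S" if "\<C> \<noteq> {}" "subset.chain S \<C>" for \<C>
  proof -
    have "subset.chain {I. ideal I R} \<C>"
      using that(2) assms(2) unfolding pred_on.chain_def by blast
    then show ?thesis
      using ideal_chain_is_trivial[OF that(1)] that(2) unfolding pred_on.chain_def by blast
  qed
  from subset_Zorn_nonempty[OF assms(1) this] show ?thesis using that by blast
qed

lemma ideal_eq_carrier:
  assumes I: "ideal I R" and not_sub: "\<And>P. maximalideal P R \<Longrightarrow> \<not> I \<subseteq> P"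
  shows "I = carrier R"
proof (rule ccontr)
  assume "I \<noteq> carrier R"
  then obtain M where M: "M \<in> {J. ideal J R \<and> I \<subseteq> J \<and> J \<noteq> carrier R}"
    "\<And>Y. Y \<in> {J. ideal J R \<and> I \<subseteq> J \<and> J \<noteq> carrier R} \<Longrightarrow> M \<subseteq> Y \<Longrightarrow> Y = M"
    by (rule_tac maximal_element[of "{J. ideal J R \<and> I \<subseteq> J \<and> J \<noteq> carrier R}"]) (use I in auto)
  have "maximalideal M R"
  proof (rule maximalidealI)
    fix J assume J: "ideal J R" "M \<subseteq> J" "J \<subseteq> carrier R"
    show "J = M \<or> J = carrier R" using M(1) M(2)[of J] J by blast
  qed (use M(1) in auto)
  then show False using not_sub M(1) by blast
qed

lemma exists_maximal_ideal: "\<exists>P. maximalideal P R"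
  using ideal_eq_carrier[OF zeroideal] by (metis one_closed singletonD zero_not_one)

text \<open>A condition that covers nonzero elements and, when \<open>R\<close> is a field, also \<open>\<zero>\<close>; this treats
  the zero ideal of a finite field on the same footing as nonzero ideals in dimension one.\<close>
definition thick :: "'a \<Rightarrow> bool" where
  "thick b \<longleftrightarrow> (\<forall>Q. primeideal Q R \<and> b \<in> Q \<longrightarrow> maximalideal Q R)"

lemma thick_nonzero: "b \<noteq> \<zero> \<Longrightarrow> thick b"
  using prime_maximal by (auto simp: thick_def)

lemma thick_field: "maximalideal {\<zero>} R \<Longrightarrow> thick b"
  using prime_maximal by (metis thick_def)

lemma thick_ideal:
  assumes "ideal I R" "I \<noteq> {\<zero>} \<or> maximalideal {\<zero>} R"
  obtains b where "b \<in> I" "thick b"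
  using assms thick_nonzero thick_field additive_subgroup.zero_closed[OF ideal.axioms(1)[OF assms(1)]]
  by blast

text \<open>A counterexample \<open>M\<close>, maximal among the ideals containing \<open>b\<close>,
  is not prime, since the statement holds for \<open>P\<close> itself with \<open>k = 1\<close> and
  for ideals not inside \<open>P\<close> with \<open>k = 0\<close>. Hence
  \<open>x \<otimes> y\<close> lies in \<open>M\<close> for some \<open>x\<close>, \<open>y\<close>
  outside it. The enlargements of \<open>M\<close> by \<open>x\<close> and by \<open>y\<close>
  satisfy the statement, and their product lies in \<open>M\<close>: exponents add and multipliers
  multiply.\<close>

lemma thick_contains_power:
  assumes P: "maximalideal P R" and I: "ideal I R" and b: "b \<in> I" "thick b"
  shows "\<exists>k. \<exists>t\<in>carrier R - P. \<forall>d\<in>ideal_pow R P k. t \<otimes> d \<in> I" (is "?good I")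
proof (rule ccontr)
  interpret P: maximal_adic R P by (rule maximal_adic[OF P])
  let ?S = "{I. ideal I R \<and> b \<in> I \<and> \<not> ?good I}"
  assume "\<not> ?good I"
  then have "?S \<noteq> {}" using I b by blast
  then obtain M where M: "M \<in> ?S" and max: "\<And>Y. Y \<in> ?S \<Longrightarrow> M \<subseteq> Y \<Longrightarrow> Y = M"
    by (rule maximal_element) auto
  interpret M: ideal M R using M by simp
  have nM: "\<not> ?good M" using M by simp
  have MR: "carrier R \<noteq> M"
  proof
    assume "carrier R = M"
    then have "?good M" using P.one_notin by (intro exI[of _ 0] bexI[of _ \<one>]) auto
    with nM show False by blast
  qed
  have "\<not> primeideal M R"
  proof
    assume "primeideal M R"
    \<comment> \<open>Thickness of \<open>b\<close> enters here: a prime ideal containing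
      \<open>b\<close> is maximal, so it equals \<open>P\<close> or is not contained in
      \<open>P\<close>.\<close>
    then have mM: "maximalideal M R" using b(2) M by (simp add: thick_def)
    have "\<not> M \<subseteq> P"
    proof
      assume "M \<subseteq> P"
      then have "P = M"
        using maximalideal.I_maximal[OF mM P.P.is_ideal] P.P.a_subset P.maximal.I_notcarr by blast
      then have "?good M"
        using P.one_notin P.pw_1 by (intro exI[of _ 1] bexI[of _ \<one>]) auto
      with nM show False by blast
    qed
    then obtain t where "t \<in> M" "t \<notin> P" by blast
    then have "?good M"
      using M.Icarr M.I_r_closed by (intro exI[of _ 0] bexI[of _ t]) auto
    with nM show False by blast
  qed
  then obtain x y where x: "x \<in> carrier R" "x \<notin> M" and y: "y \<in> carrier R" "y \<notin> M"
    and xy: "x \<otimes> y \<in> M"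
    using primeidealI[OF M.is_ideal is_cring MR] by blast
  have *: "?good (M <+>\<^bsub>R\<^esub> PIdl z)" if z: "z \<in> carrier R" "z \<notin> M" for z
  proof -
    have i: "ideal (M <+>\<^bsub>R\<^esub> PIdl z) R" using add_ideals[OF M.is_ideal cgenideal_ideal[OF z(1)]] .
    have sum: "m \<oplus> p \<in> M <+>\<^bsub>R\<^esub> PIdl z" if "m \<in> M" "p \<in> PIdl z" for m p
      using that unfolding set_add_def' by blast
    have sub: "M \<subseteq> M <+>\<^bsub>R\<^esub> PIdl z"
    proof
      fix m assume "m \<in> M"
      then show "m \<in> M <+>\<^bsub>R\<^esub> PIdl z"
        using sum[of m \<zero>] M.Icarr[of m]
          additive_subgroup.zero_closed[OF ideal.axioms(1)[OF cgenideal_ideal[OF z(1)]]] by simp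
    qed
    have "z \<in> M <+>\<^bsub>R\<^esub> PIdl z"
      using sum[OF M.zero_closed cgenideal_self[OF z(1)]] z(1) by simp
    then have "M <+>\<^bsub>R\<^esub> PIdl z \<noteq> M" using z(2) by blast
    then have "M <+>\<^bsub>R\<^esub> PIdl z \<notin> ?S" using max sub by blast
    then show ?thesis using i sub M by blast
  qed
  obtain k s where s: "s \<in> carrier R" "s \<notin> P" "\<And>d. d \<in> P.pw k \<Longrightarrow> s \<otimes> d \<in> M <+>\<^bsub>R\<^esub> PIdl x"
    using *[OF x] by blast
  obtain l t where t: "t \<in> carrier R" "t \<notin> P" "\<And>d. d \<in> P.pw l \<Longrightarrow> t \<otimes> d \<in> M <+>\<^bsub>R\<^esub> PIdl y"
    using *[OF y] by blast
  have cross: "u \<otimes> v \<in> M" if u: "u \<in> M <+>\<^bsub>R\<^esub> PIdl x" and v: "v \<in> M <+>\<^bsub>R\<^esub> PIdl y" for u v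
  proof -
    obtain m p where m: "m \<in> M" "p \<in> carrier R" "u = m \<oplus> p \<otimes> x"
      using u unfolding set_add_def' cgenideal_def by blast
    obtain m' q where m': "m' \<in> M" "q \<in> carrier R" "v = m' \<oplus> q \<otimes> y"
      using v unfolding set_add_def' cgenideal_def by blast
    have "u \<otimes> v = m \<otimes> v \<oplus> ((p \<otimes> x) \<otimes> m' \<oplus> (p \<otimes> q) \<otimes> (x \<otimes> y))"
      using m m' x(1) y(1) M.Icarr by (simp add: l_distr r_distr m_ac)
    also have "\<dots> \<in> M"
      using m m' x(1) y(1) xy M.Icarr M.a_closed M.I_l_closed M.I_r_closed by simp
    finally show ?thesis .
  qed
  have "(s \<otimes> t) \<otimes> d \<in> M" if "d \<in> P.pw (k + l)" for d
  proof -
    from that have "d \<in> P.pw k \<cdot> P.pw l" by (simp add: P.pw_add)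
    then show ?thesis
    proof (induction d rule: ideal_prod.induct)
      case (prod i j)
      have c: "i \<in> carrier R" "j \<in> carrier R" using prod P.pw_carr by auto
      have "(s \<otimes> t) \<otimes> (i \<otimes> j) = (s \<otimes> i) \<otimes> (t \<otimes> j)"
        using c s(1) t(1) by (simp add: m_ac)
      then show ?case using cross[OF s(3)[OF prod(1)] t(3)[OF prod(2)]] by simp
    next
      case (sum i j)
      have "i \<in> carrier R" "j \<in> carrier R"
        using sum(1,2) ideal_prod_in_carrier[OF P.ideal_pw P.ideal_pw] by blast+
      then show ?case using sum(3,4) s(1) t(1) by (simp add: r_distr M.a_closed)
    qed
  qed
  then have "?good M"
    using P.mult_notin s(1,2) t(1,2) by (intro exI[of _ "k + l"] bexI[of _ "s \<otimes> t"]) auto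
  with nM show False by blast
qed

lemma thick_loc:
  assumes P: "maximalideal P R" and I: "ideal I R" and b: "b \<in> I" "thick b"
  obtains k where "ideal_pow R P k \<subseteq> maximal_adic.loc R P I"
proof -
  interpret P: maximal_adic R P by (rule maximal_adic[OF P])
  obtain k t where t: "t \<in> carrier R" "t \<notin> P" "\<And>d. d \<in> P.pw k \<Longrightarrow> t \<otimes> d \<in> I"
    using thick_contains_power[OF P I b] by blast
  then have "P.pw k \<subseteq> P.loc I" using P.locI P.pw_carr by blast
  then show ?thesis by (rule that)
qed

text \<open>The exponents may depend on \<open>P\<close>: the elements \<open>x\<close> for which some \<open>x a\<^sup>N c\<close> lies in \<open>I\<close> form an
  ideal contained in no maximal ideal.\<close>
lemma local_global:
  assumes I: "ideal I R" and a: "a \<in> carrier R" and c: "c \<in> carrier R"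
    and loc: "\<And>P. maximalideal P R \<Longrightarrow> \<exists>N::nat. a [^] N \<otimes> c \<in> maximal_adic.loc R P I"
  shows "\<exists>N::nat. a [^] N \<otimes> c \<in> I"
proof -
  interpret I: ideal I R by (rule I)
  let ?J = "{x \<in> carrier R. \<exists>N::nat. x \<otimes> (a [^] N \<otimes> c) \<in> I}"
  have "ideal ?J R"
  proof (rule idealI[OF ring_axioms])
    show "subgroup ?J (add_monoid R)"
    proof
      fix x y assume "x \<in> ?J" "y \<in> ?J"
      then obtain N M :: nat where x: "x \<in> carrier R" "x \<otimes> (a [^] N \<otimes> c) \<in> I"
        and y: "y \<in> carrier R" "y \<otimes> (a [^] M \<otimes> c) \<in> I" by blast
      have "(x \<oplus> y) \<otimes> (a [^] (N + M) \<otimes> c)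
          = a [^] M \<otimes> (x \<otimes> (a [^] N \<otimes> c)) \<oplus> a [^] N \<otimes> (y \<otimes> (a [^] M \<otimes> c))"
        using x(1) y(1) a c by (simp add: nat_pow_mult[symmetric] l_distr r_distr m_ac)
      \<comment> \<open>Summing the exponents serves both elements at once, so \<open>?J\<close> is
        closed under addition although the exponent varies.\<close>
      also have "\<dots> \<in> I" using x y a I.I_l_closed I.a_closed by simp
      finally have "(x \<oplus> y) \<otimes> (a [^] (N + M) \<otimes> c) \<in> I" .
      then show "x \<otimes>\<^bsub>add_monoid R\<^esub> y \<in> ?J" using x(1) y(1) by auto
    next
      fix x assume "x \<in> ?J"
      then show "inv\<^bsub>add_monoid R\<^esub> x \<in> ?J"
        unfolding a_inv_def[symmetric] using a c by (auto simp: l_minus)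
    qed (use a c I.zero_closed in auto)
    show l: "r \<otimes> x \<in> ?J" if x: "x \<in> ?J" and r: "r \<in> carrier R" for x r
    proof -
      from x obtain N :: nat where N: "x \<in> carrier R" "x \<otimes> (a [^] N \<otimes> c) \<in> I" by blast
      have "(r \<otimes> x) \<otimes> (a [^] N \<otimes> c) \<in> I"
        using I.I_l_closed[OF N(2) r] N(1) r a c by (simp add: m_assoc)
      then show ?thesis using N(1) r by blast
    qed
    show "x \<otimes> r \<in> ?J" if x: "x \<in> ?J" and r: "r \<in> carrier R" for x r
      using l[OF x r] x r by (simp add: m_comm)
  qed
  \<comment> \<open>The multiplier outside \<open>P\<close> that witnesses membership in the
    localised ideal is an element of \<open>?J\<close>.\<close>
  moreover have "\<not> ?J \<subseteq> P" if P: "maximalideal P R" for P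
  proof -
    interpret P: maximal_adic R P by (rule maximal_adic[OF P])
    obtain N :: nat where "a [^] N \<otimes> c \<in> P.loc I" using loc[OF P] by blast
    then show ?thesis by (blast elim: P.locE)
  qed
  ultimately have "?J = carrier R" by (rule ideal_eq_carrier)
  then have "\<one> \<in> ?J" by simp
  then show ?thesis using a c by simp
qed

section \<open>Congruing ideals contain thick elements\<close>

lemma power_ne_one:
  assumes P: "maximalideal P R" and n: "n > 0" and a: "a \<in> P"
  shows "a [^] (n::nat) \<noteq> \<one>"
proof
  interpret P: maximal_adic R P by (rule maximal_adic[OF P])
  assume 1: "a [^] n = \<one>"
  obtain m where "n = Suc m" using n gr0_conv_Suc by blast
  then have "a [^] n \<in> P" using P.P.I_l_closed[OF a] P.P.Icarr[OF a] by simp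
  then show False using 1 P.one_notin by simp
qed

lemma congruing_element_nonzero:
  assumes "maximalideal P R" "(n::nat) > 0" "a \<in> P" "a \<noteq> \<zero>"
  shows "a [^] (N::nat) \<otimes> (a [^] n \<ominus> \<one>) \<noteq> \<zero>"
proof -
  have a: "a \<in> carrier R" using assms(3) ideal.Icarr[OF maximalideal.axioms(1)[OF assms(1)]] by blast
  have "a [^] N \<noteq> \<zero>" using a assms(4) by (induction N) (auto simp: integral_iff)
  then show ?thesis using a power_ne_one[OF assms(1-3)] by (simp add: integral_iff)
qed

lemma nonzero_element:
  assumes "maximalideal P R" "\<not> maximalideal {\<zero>} R"
  obtains a where "a \<in> P" "a \<noteq> \<zero>"
proof -
  have "P \<noteq> {\<zero>}" "\<zero> \<in> P"
    using assms additive_subgroup.zero_closed[OF ideal.axioms(1)[OF maximalideal.axioms(1)]] by blast+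
  then show ?thesis using that by blast
qed

text \<open>By \<open>thick_ideal\<close> only the zero ideal of a non-field must be excluded. There
  a nonzero \<open>a\<close> in a maximal ideal has no vanishing
  \<open>a^N (a^n - 1)\<close>.\<close>

lemma n_congruing_thick:
  assumes "n_congruing R n I" "n > 0"
  obtains b where "b \<in> I" "thick b"
proof (rule thick_ideal)
  show "ideal I R" using assms(1) by (simp add: n_congruing_def)
  show "I \<noteq> {\<zero>} \<or> maximalideal {\<zero>} R"
  proof (rule ccontr, safe)
    assume I: "I = {\<zero>}" and nf: "\<not> maximalideal {\<zero>} R"
    obtain P where P: "maximalideal P R" using exists_maximal_ideal by blast
    obtain a where a: "a \<in> P" "a \<noteq> \<zero>" by (rule nonzero_element[OF P nf])
    have "a \<in> carrier R" using a(1) ideal.Icarr[OF maximalideal.axioms(1)[OF P]] by blast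
    then show False
      using assms(1) congruing_element_nonzero[OF P assms(2) a] I unfolding n_congruing_def by blast
  qed
qed blast

text \<open>As in \<open>n_congruing_thick\<close>, except that the nonzero element \<open>c\<close>
  now vanishes only after completion. The contradiction amounts to injectivity of the completion map
  at \<open>c\<close>.\<close>

lemma compl_n_congruing_thick:
  assumes I: "ideal I R" and P: "maximalideal P R" and n: "n > 0"
    and cong: "n_congruing (completion R P) n (compl_ideal R P I)"
  obtains b where "b \<in> I" "thick b"
proof (rule thick_ideal[OF I])
  interpret P: maximal_adic R P by (rule maximal_adic[OF P])
  show "I \<noteq> {\<zero>} \<or> maximalideal {\<zero>} R"
  proof (rule ccontr, safe)
    assume I0: "I = {\<zero>}" and nf: "\<not> maximalideal {\<zero>} R"
    obtain a where a: "a \<in> P" "a \<noteq> \<zero>" by (rule nonzero_element[OF P nf])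
    have ac: "a \<in> carrier R" using a(1) P.P.Icarr by blast
    obtain N :: nat where N: "P.emb (a [^] N \<otimes> (a [^] n \<ominus> \<one>)) \<in> compl_ideal R P I"
      using P.n_congruing_emb[OF cong ac] by blast
    define c where "c = a [^] N \<otimes> (a [^] n \<ominus> \<one>)"
    have cc: "c \<in> carrier R" and c0: "c \<noteq> \<zero>"
      using ac congruing_element_nonzero[OF P n a] by (simp_all add: c_def)
    have ca: "c \<otimes> a \<in> carrier R" "c \<otimes> a \<noteq> \<zero>" using cc ac a c0 by (simp_all add: integral_iff)
    \<comment> \<open>The localisation of this ideal contains a power of \<open>P\<close>, so
      contraction applies and yields \<open>c\<close> in it. Cancelling \<open>c\<close> then makes
      the multiplier \<open>s\<close> a multiple of \<open>a\<close>, hence an element of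
      \<open>P\<close>.\<close>
    let ?J = "PIdl (c \<otimes> a)"
    have J: "ideal ?J R" by (rule cgenideal_ideal[OF ca(1)])
    obtain k where k: "P.pw k \<subseteq> P.loc ?J"
      by (rule thick_loc[OF P J cgenideal_self[OF ca(1)] thick_nonzero[OF ca(2)]])
    have "I \<subseteq> P.loc ?J"
      using I0 additive_subgroup.zero_closed[OF ideal.axioms(1)[OF P.ideal_loc[OF J]]] by simp
    then have "c \<in> P.loc ?J"
      using P.compl_ideal_contract[OF P.ideal_loc[OF J] k _ cc] N by (simp add: c_def)
    then obtain s where s: "s \<in> carrier R" "s \<notin> P" "s \<otimes> c \<in> ?J" by (rule P.locE)
    then obtain r where r: "r \<in> carrier R" "s \<otimes> c = r \<otimes> (c \<otimes> a)"
      unfolding cgenideal_def by blast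
    then have "s \<otimes> c = (r \<otimes> a) \<otimes> c" using cc ac by (simp add: m_ac)
    then have "s = r \<otimes> a" using m_rcancel[OF c0 cc s(1)] r(1) ac by simp
    then show False using s(2) P.P.I_l_closed[OF a(1) r(1)] by simp
  qed
qed blast

section \<open>Congruing in the ring and in all its completions\<close>

theorem n_congruing_completion:
  assumes "n_congruing R n I" "n > 0" and P: "maximalideal P R"
  shows "n_congruing (completion R P) n (compl_ideal R P I)"
proof -
  interpret P: maximal_adic R P by (rule maximal_adic[OF P])
  obtain b where b: "b \<in> I" "thick b" by (rule n_congruing_thick[OF assms(1,2)])
  have I: "ideal I R" using assms(1) by (simp add: n_congruing_def)
  have bc: "b \<in> carrier R" by (rule ideal.Icarr[OF I b(1)])
  \<comment> \<open>The principal ideal of \<open>b\<close> is used in place of \<open>I\<close>, so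
    that each \<open>t \<otimes> d\<close> is an explicit multiple of the single element
    \<open>b\<close>.\<close>
  obtain k t where t: "t \<in> carrier R" "t \<notin> P" "\<And>d. d \<in> P.pw k \<Longrightarrow> t \<otimes> d \<in> PIdl b"
    using thick_contains_power[OF P cgenideal_ideal[OF bc] cgenideal_self[OF bc] b(2)] by blast
  show ?thesis
  proof (rule P.n_congruing_compl_ideal[OF assms(1) b(1) t(1) P.Units_emb[OF t(1,2)]])
    fix d assume "d \<in> P.pw k"
    from t(3)[OF this] obtain e where e: "e \<in> carrier R" "t \<otimes> d = e \<otimes> b"
      unfolding cgenideal_def by blast
    show "\<exists>e\<in>carrier R. t \<otimes> d = b \<otimes> e"
      using e m_comm[OF bc e(1)] by (intro bexI[of _ e]) simp_all
  qed
qed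

text \<open>At each \<open>P\<close> the relation for \<open>emb a\<close> contracts to the
  localised ideal, which contains a power of \<open>P\<close>. The exponents found for the various
  \<open>P\<close> are merged by \<open>local_global\<close>.\<close>

theorem n_congruing_of_completions:
  assumes I: "ideal I R" and n: "n > 0"
    and cong: "\<And>P. maximalideal P R \<Longrightarrow> n_congruing (completion R P) n (compl_ideal R P I)"
  shows "n_congruing R n I"
proof -
  have "\<exists>N::nat. a [^] N \<otimes> (a [^] n \<ominus> \<one>) \<in> maximal_adic.loc R P I"
    if a: "a \<in> carrier R" and P: "maximalideal P R" for a P
  proof -
    interpret P: maximal_adic R P by (rule maximal_adic[OF P])
    obtain b where b: "b \<in> I" "thick b" by (rule compl_n_congruing_thick[OF I P n cong[OF P]])
    obtain k where k: "P.pw k \<subseteq> P.loc I" by (rule thick_loc[OF P I b])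
    obtain N :: nat where N: "P.emb (a [^] N \<otimes> (a [^] n \<ominus> \<one>)) \<in> compl_ideal R P I"
      using P.n_congruing_emb[OF cong[OF P] a] by blast
    have "a [^] N \<otimes> (a [^] n \<ominus> \<one>) \<in> P.loc I"
      using P.compl_ideal_contract[OF P.ideal_loc[OF I] k P.subset_loc[OF I] _ N] a by simp
    then show ?thesis by blast
  qed
  then have "\<exists>N::nat. a [^] N \<otimes> (a [^] n \<ominus> \<one>) \<in> I" if "a \<in> carrier R" for a
    using local_global[OF I that] that by simp
  then show ?thesis using I by (simp add: n_congruing_def)
qed

section \<open>The kernel of the map to the product\<close>

lemma mem_ker_pr_iff:
  "a \<in> ker_pr R n \<longleftrightarrow> a \<in> carrier R \<and> (\<forall>P. maximalideal P R \<longrightarrow> compl_map R P a \<in> H_ideal R n P)"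
proof -
  have "pr_comp R n P a = \<zero>\<^bsub>completion R P Quot H_ideal R n P\<^esub> \<longleftrightarrow> compl_map R P a \<in> H_ideal R n P"
    if "a \<in> carrier R" "maximalideal P R" for P
    using adic.pr_comp_eq_zero_iff[OF maximal_adic.axioms(1)[OF maximal_adic[OF that(2)]] that(1)] .
  then show ?thesis by (auto simp: ker_pr_def)
qed

text \<open>For \<open>r\<close> outside \<open>P\<close> the factor \<open>r^N\<close> in the
  congruing relation is also outside \<open>P\<close> and is absorbed by localisation. Hence
  \<open>r^n - 1\<close> lies in every localised ideal, and \<open>H_ideal_contract\<close>
  applies.\<close>

theorem ker_pr_subset:
  assumes cong: "n_congruing R n I" and n: "n > 0"
  shows "ker_pr R n \<subseteq> I"
proof
  have I: "ideal I R" using cong by (simp add: n_congruing_def)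
  fix a assume "a \<in> ker_pr R n"
  then have a: "a \<in> carrier R"
    and H: "\<And>P. maximalideal P R \<Longrightarrow> compl_map R P a \<in> H_ideal R n P"
    by (auto simp: mem_ker_pr_iff)
  obtain b where b: "b \<in> I" "thick b" by (rule n_congruing_thick[OF cong n])
  have "a \<in> maximal_adic.loc R P I" if P: "maximalideal P R" for P
  proof -
    interpret P: maximal_adic R P by (rule maximal_adic[OF P])
    obtain k where k: "P.pw k \<subseteq> P.loc I" by (rule thick_loc[OF P I b])
    have "r [^] n \<ominus> \<one> \<in> P.loc I" if r: "r \<in> carrier R" "r \<notin> P" for r
    proof -
      obtain N :: nat where "r [^] N \<otimes> (r [^] n \<ominus> \<one>) \<in> I"
        using cong r(1) unfolding n_congruing_def by blast
      then show ?thesis using P.locI[of _ "r [^] N"] P.pow_notin r by simp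
    qed
    then show ?thesis using P.H_ideal_contract[OF P.ideal_loc[OF I] k _ a H[OF P]] by blast
  qed
  \<comment> \<open>With base \<open>\<one>\<close> the powers are trivial, so
    \<open>local_global\<close> turns membership in all localised ideals into membership in
    \<open>I\<close>.\<close>
  then have "\<exists>N::nat. \<one> [^] N \<otimes> a \<in> I"
    using a by (intro local_global[OF I]) auto
  then show "a \<in> I" using a by simp
qed

text \<open>The elements \<open>1 + a\<^sup>i\<close> with \<open>0 \<noteq> a \<in> P\<close> are pairwise distinct and lie outside \<open>P\<close>.\<close>
lemma exists_nontrivial_power:
  assumes P: "maximalideal P R" and nf: "\<not> maximalideal {\<zero>} R" and n: "n > 0"
  obtains x where "x \<in> carrier R" "x \<notin> P" "x [^] (n::nat) \<noteq> \<one>"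
proof -
  interpret P: maximal_adic R P by (rule maximal_adic[OF P])
  obtain a where a: "a \<in> P" "a \<noteq> \<zero>" by (rule nonzero_element[OF P nf])
  have ac: "a \<in> carrier R" using a(1) P.P.Icarr by blast
  have nz: "a [^] m \<noteq> \<zero>" for m :: nat
    using ac a(2) by (induction m) (simp_all add: integral_iff)
  have neq: "a [^] i \<noteq> a [^] j" if "i < j" for i j :: nat
  proof
    assume eq: "a [^] i = a [^] j"
    have "a [^] i \<otimes> a [^] (j - i) = a [^] i \<otimes> \<one>"
      using that ac by (simp add: nat_pow_mult eq[symmetric])
    then have "a [^] (j - i) = \<one>"
      using m_lcancel[OF nz nat_pow_closed[OF ac] nat_pow_closed[OF ac] one_closed] by blast
    then show False using power_ne_one[OF P _ a(1), of "j - i"] that by simp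
  qed
  define f where "f i = \<one> \<oplus> a [^] Suc i" for i
  have pc: "a [^] Suc i \<in> carrier R" for i by (rule nat_pow_closed[OF ac])
  have fc: "f i \<in> carrier R" for i unfolding f_def by (rule a_closed[OF one_closed pc])
  have "inj f"
  proof (rule injI)
    fix i j assume "f i = f j"
    then have eq: "a [^] Suc i = a [^] Suc j"
      unfolding f_def by (rule add.l_cancel[OF _ pc pc one_closed])
    show "i = j"
    proof (rule ccontr)
      assume "i \<noteq> j"
      then consider "Suc i < Suc j" | "Suc j < Suc i" by linarith
      then show False using neq eq by cases metis+
    qed
  qed
  have fP: "f i \<notin> P" for i
  proof
    assume f: "f i \<in> P"
    have "a [^] Suc i \<in> P" using P.P.I_l_closed[OF a(1), of "a [^] i"] ac by simp
    then have "f i \<oplus> \<ominus> (a [^] Suc i) \<in> P" using P.P.a_closed[OF f] P.P.a_inv_closed by blast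
    moreover have "f i \<oplus> \<ominus> (a [^] Suc i) = \<one>"
      unfolding f_def using pc[of i] by (simp only: a_assoc one_closed a_inv_closed r_neg r_zero)
    ultimately show False using P.one_notin by simp
  qed
  \<comment> \<open>Infinitely many values of \<open>f\<close> cannot all be among the finitely many
    n-th roots of unity of a domain.\<close>
  have "\<not> range f \<subseteq> {x \<in> carrier R. x [^] n = \<one>}"
    using finite_roots_of_unity[OF n] finite_subset range_inj_infinite[OF \<open>inj f\<close>] by blast
  then obtain i where "f i [^] n \<noteq> \<one>" using fc by blast
  then show ?thesis using that[OF fc fP] by blast
qed

text \<open>The contraction \<open>?J\<close> of the ideal to \<open>R\<close> has a thick element,
  for outside the field case it contains some nonzero \<open>x^n - 1\<close>. So
  \<open>t \<otimes> a [^] k\<close> lies in it for some \<open>k\<close> and some \<open>t\<close>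
  outside \<open>P\<close>, and \<open>t\<close> is invertible in the completion.\<close>

lemma power_mem_H_ideal:
  assumes P: "maximalideal P R" and n: "n > 0" and a: "a \<in> P"
  shows "\<exists>N::nat. compl_map R P (a [^] N) \<in> H_ideal R n P"
proof -
  interpret P: maximal_adic R P by (rule maximal_adic[OF P])
  interpret H: ideal "H_ideal R n P" P.C by (rule P.ideal_H_ideal)
  have ac: "a \<in> carrier R" using a P.P.Icarr by blast
  let ?J = "{r \<in> carrier R. P.emb r \<in> H_ideal R n P}"
  have J: "ideal ?J R" by (rule P.emb.ideal_vimage[OF P.ideal_H_ideal])
  have "?J \<noteq> {\<zero>} \<or> maximalideal {\<zero>} R"
  proof (rule disjCI)
    assume nf: "\<not> maximalideal {\<zero>} R"
    obtain x where x: "x \<in> carrier R" "x \<notin> P" "x [^] n \<noteq> \<one>"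
      by (rule exists_nontrivial_power[OF P nf n])
    have "P.emb (x [^] n \<ominus> \<one>) \<in> H_ideal R n P"
      unfolding P.emb_power_minus_one[OF x(1)]
      by (rule P.H_ideal_gen[OF P.Units_emb[OF x(1,2)]])
    then have "x [^] n \<ominus> \<one> \<in> ?J" using x(1) by simp
    moreover have "x [^] n \<ominus> \<one> \<noteq> \<zero>" using x by simp
    ultimately show "?J \<noteq> {\<zero>}" by blast
  qed
  then obtain b where b: "b \<in> ?J" "thick b" by (rule thick_ideal[OF J])
  obtain k t where t: "t \<in> carrier R" "t \<notin> P" "\<And>d. d \<in> P.pw k \<Longrightarrow> t \<otimes> d \<in> ?J"
    using thick_contains_power[OF P J b] by blast
  have U: "P.emb t \<in> Units P.C" by (rule P.Units_emb[OF t(1,2)])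
  have ec: "P.emb t \<in> carrier P.C" "P.emb (a [^] k) \<in> carrier P.C" using t(1) ac by simp_all
  have "P.emb (t \<otimes> a [^] k) \<in> H_ideal R n P" using t(3)[OF P.pw_power[OF a]] by simp
  then have "P.emb t \<otimes>\<^bsub>P.C\<^esub> P.emb (a [^] k) \<in> H_ideal R n P"
    using P.emb.hom_mult[OF t(1) nat_pow_closed[OF ac]] by simp
  then have "inv\<^bsub>P.C\<^esub> P.emb t \<otimes>\<^bsub>P.C\<^esub> (P.emb t \<otimes>\<^bsub>P.C\<^esub> P.emb (a [^] k)) \<in> H_ideal R n P"
    by (rule H.I_l_closed) (rule P.C.Units_inv_closed[OF U])
  also have "inv\<^bsub>P.C\<^esub> P.emb t \<otimes>\<^bsub>P.C\<^esub> (P.emb t \<otimes>\<^bsub>P.C\<^esub> P.emb (a [^] k)) = P.emb (a [^] k)"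
    using P.C.m_assoc[OF P.C.Units_inv_closed[OF U] ec] P.C.Units_l_inv[OF U] P.C.l_one[OF ec(2)]
    by metis
  finally show ?thesis by blast
qed

lemma ideal_ker_pr: "ideal (ker_pr R n) R"
proof -
  let ?K = "\<lambda>P. {r \<in> carrier R. compl_map R P r \<in> H_ideal R n P}"
  have "ideal (?K P) R" if P: "maximalideal P R" for P
  proof -
    interpret P: maximal_adic R P by (rule maximal_adic[OF P])
    show ?thesis by (rule P.emb.ideal_vimage[OF P.ideal_H_ideal])
  qed
  \<comment> \<open>An intersection of ideals is formed over a nonempty family, whence the appeal to
    the existence of a maximal ideal.\<close>
  then have "ideal (\<Inter> (?K ` {P. maximalideal P R})) R"
    using exists_maximal_ideal by (intro i_Intersect) auto
  also have "\<Inter> (?K ` {P. maximalideal P R}) = ker_pr R n"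
    using exists_maximal_ideal by (auto simp: mem_ker_pr_iff)
  finally show ?thesis .
qed

text \<open>For \<open>a\<close> outside \<open>P\<close> the factor \<open>a^n - 1\<close> is in
  the ideal at \<open>P\<close>. For \<open>a\<close> in \<open>P\<close> either the residue field
  is large and that ideal is everything, or \<open>P\<close> is one of finitely many ideals, each of
  which requires some power of \<open>a\<close>.\<close>

theorem n_congruing_ker_pr:
  assumes n: "n > 0"
    and fin: "\<And>P. maximalideal P R \<Longrightarrow> finite (carrier (R Quot P))"
    and few: "finite {P. maximalideal P R \<and> card (carrier (R Quot P)) < n + 2}"
  shows "n_congruing R n (ker_pr R n)"
  unfolding n_congruing_def
proof (intro conjI ideal_ker_pr ballI)
  fix a assume a: "a \<in> carrier R"
  let ?F = "{P. maximalideal P R \<and> card (carrier (R Quot P)) < n + 2}"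
  have "\<forall>P\<in>?F. \<exists>N::nat. a \<in> P \<longrightarrow> compl_map R P (a [^] N) \<in> H_ideal R n P"
  proof
    fix P assume "P \<in> ?F"
    then have "maximalideal P R" by simp
    from power_mem_H_ideal[OF this n]
    show "\<exists>N::nat. a \<in> P \<longrightarrow> compl_map R P (a [^] N) \<in> H_ideal R n P" by blast
  qed
  from bchoice[OF this] obtain f :: "'a set \<Rightarrow> nat"
    where "\<forall>P\<in>?F. a \<in> P \<longrightarrow> compl_map R P (a [^] f P) \<in> H_ideal R n P" ..
  then have f: "compl_map R P (a [^] f P) \<in> H_ideal R n P" if "P \<in> ?F" "a \<in> P" for P
    using that by blast
  \<comment> \<open>The sum dominates \<open>f P\<close> for each \<open>P\<close> in
    \<open>?F\<close>; values at ideals not containing \<open>a\<close> are arbitrary and only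
    enlarge it.\<close>
  define N where "N = sum f ?F"
  have "compl_map R P (a [^] N \<otimes> (a [^] n \<ominus> \<one>)) \<in> H_ideal R n P" if P: "maximalideal P R" for P
  proof -
    interpret P: maximal_adic R P by (rule maximal_adic[OF P])
    interpret H: ideal "H_ideal R n P" P.C by (rule P.ideal_H_ideal)
    have c: "a [^] M \<in> carrier R" "a [^] n \<ominus> \<one> \<in> carrier R" for M :: nat using a by simp_all
    show ?thesis
    proof (cases "a \<in> P")
      case False
      then have "P.emb (a [^] n \<ominus> \<one>) \<in> H_ideal R n P"
        using P.H_ideal_gen[OF P.Units_emb[OF a]] P.emb_power_minus_one[OF a] by simp
      then show ?thesis
        unfolding P.emb.hom_mult[OF c] by (rule H.I_l_closed) (rule P.emb.hom_closed[OF c(1)])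
    next
      case True
      show ?thesis
      proof (cases "P \<in> ?F")
        case True
        then have "f P \<le> N" unfolding N_def using few by (intro member_le_sum) auto
        then have "a [^] f P \<otimes> a [^] (N - f P) = a [^] N" using a by (simp add: nat_pow_mult)
        then have eq: "a [^] N \<otimes> (a [^] n \<ominus> \<one>)
            = a [^] f P \<otimes> (a [^] (N - f P) \<otimes> (a [^] n \<ominus> \<one>))"
          using m_assoc[OF c(1) c(1) c(2)] by metis
        have c': "a [^] (N - f P) \<otimes> (a [^] n \<ominus> \<one>) \<in> carrier R" using a by simp
        show ?thesis unfolding eq P.emb.hom_mult[OF c(1) c']
          by (rule H.I_r_closed[OF f[OF True \<open>a \<in> P\<close>] P.emb.hom_closed[OF c']])
      next
        case False
        then have "n + 2 \<le> card (carrier (R Quot P))" using P by simp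
        then obtain r where "r \<in> carrier R" "r \<notin> P" "r [^] n \<ominus> \<one> \<notin> P"
          by (rule P.large_residue_field[OF n fin[OF P]])
        then have "H_ideal R n P = carrier P.C" by (rule P.H_ideal_eq_carrier)
        then show ?thesis using P.emb.hom_closed[OF m_closed[OF c]] by (simp only:)
      qed
    qed
  qed
  then show "\<exists>N::nat. a [^] N \<otimes> (a [^] n \<ominus> \<one>) \<in> ker_pr R n"
    using a by (intro exI[of _ N]) (simp add: mem_ker_pr_iff)
qed

end

section \<open>Minkowski Dedekind domains\<close>

lemma minkowski_imp_dim1: "minkowski R \<Longrightarrow> dim1_noetherian_domain R"
  by (simp add: minkowski_def dedekind_domain_def dim1_noetherian_domain_def
      dim1_noetherian_domain_axioms_def)

theorem mainTheorem10:
  fixes R :: "('a, 'b) ring_scheme" and n :: nat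
  assumes "minkowski R" and "n > 0"
  shows "(\<forall>I. ideal I R \<longrightarrow>
            (n_congruing R n I \<longleftrightarrow>
               (\<forall>P. maximalideal P R \<longrightarrow> n_congruing (completion R P) n (compl_ideal R P I)))
          \<and> (n_congruing R n I \<longleftrightarrow> ker_pr R n \<subseteq> I))
       \<and> n_congruing R n (ker_pr R n)
       \<and> (\<forall>J. n_congruing R n J \<longrightarrow> ker_pr R n \<subseteq> J)
       \<and> (\<forall>J. n_congruing R n J \<and> (\<forall>K. n_congruing R n K \<and> K \<subseteq> J \<longrightarrow> K = J)
              \<longrightarrow> J = ker_pr R n)"
proof -
  interpret dim1_noetherian_domain R by (rule minkowski_imp_dim1[OF assms(1)])
  have ker: "n_congruing R n (ker_pr R n)"
    using assms n_congruing_ker_pr unfolding minkowski_def by blast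
  \<comment> \<open>The congruing condition passes to larger ideals, so it suffices that the kernel
    satisfies it.\<close>
  have sup: "n_congruing R n I" if "ideal I R" "ker_pr R n \<subseteq> I" for I
    using ker that unfolding n_congruing_def by blast
  have sub: "ker_pr R n \<subseteq> I" if "n_congruing R n I" for I
    using ker_pr_subset[OF that assms(2)] .
  have completions: "n_congruing R n I \<longleftrightarrow>
      (\<forall>P. maximalideal P R \<longrightarrow> n_congruing (completion R P) n (compl_ideal R P I))"
    if "ideal I R" for I
    using n_congruing_completion[OF _ assms(2), of I] n_congruing_of_completions[OF that assms(2)]
    by (intro iffI allI impI) simp_all
  show ?thesis
  proof (intro conjI allI impI)
    fix I assume I: "ideal I R"
    show "n_congruing R n I \<longleftrightarrow>
        (\<forall>P. maximalideal P R \<longrightarrow> n_congruing (completion R P) n (compl_ideal R P I))"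
      by (rule completions[OF I])
    show "n_congruing R n I \<longleftrightarrow> ker_pr R n \<subseteq> I"
      using sup[OF I] sub by (rule iffI[rotated])
  next
    fix J assume "n_congruing R n J \<and> (\<forall>K. n_congruing R n K \<and> K \<subseteq> J \<longrightarrow> K = J)"
    \<comment> \<open>The kernel is congruing and contained in \<open>J\<close>, so minimality of
      \<open>J\<close> forces equality.\<close>
    then show "J = ker_pr R n" using ker sub by metis
  qed (simp_all only: ker sub)
qed

end
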